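(* Consider the extended Random Priority algorithm (defined in the context) applied to a strict intensity profile with $n$ agents and $n$ items. For all realizations of the randomly drawn orders, the algorithm ends in at most $\binom n2$ steps (pairwise searches)---hence in $O(n^2)$ time---and the final allocation it produces is either the Pareto-efficient allocation $x$ found in its Random Priority step, or an allocation that intensity-dominates $x$.
   Context: Let $A$ be a set of $n$ items and $N=\{1,\dots,n\}$ a set of $n$ agents. The intensity relation of agent $l$ is a binary relation $\dot{\succsim}_l$ on $A\times A$ with symmetric part $\dot{\sim}_l$; its induced preference on $A$ is $a\succsim_l b \Leftrightarrow (a,b)\,\dot{\succsim}_l\,(b,a)$, with asymmetric part $\succ_l$. $\dot{\succsim}_l$ is representable by a preference intensity function if there is $s_l:A\times A\to\mathbb{R}$ such that for all $a,b,c,d,e\in A$: (i) $(a,b)\,\dot{\succsim}_l\,(c,d)\Leftrightarrow s_l(a,b)\ge s_l(c,d)$; (ii) $(a,b)\,\dot{\succsim}_l\,(b,a)\Leftrightarrow s_l(a,b)\ge s_l(e,e)\ge s_l(b,a)$; (iii) $\min\{s_l(a,b),s_l(b,c)\}\ge s_l(e,e)$ implies $s_l(a,c)\ge\max\{s_l(a,b),s_l(b,c)\}$, and a strict inequality in the hypothesis implies a strict inequality in the conclusion; (iv) (reversal) $s_l(a,b)\ge s_l(c,d)\Leftrightarrow s_l(d,c)\ge s_l(b,a)$. Strictness: $(a,b)\,\dot{\sim}_l\,(c,d)$ fails for all distinct pairs $(a,b)\neq(c,d)$ with $a\ne b$, $c\ne d$. A strict intensity profile is a tuple $(\dot{\succsim}_1,\dots,\dot{\succsim}_n)$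 of representable relations satisfying Strictness; each induced preference is then a strict linear order. From now on $s_l$ denotes the canonical representation of $\dot{\succsim}_l$, i.e. the one with range $\{-k,\dots,-1,0,1,\dots,k\}$, $k=\binom n2$; it satisfies $s_l(a,a)=0$, $s_l(a,b)=-s_l(b,a)$ and $s_l(a,b)>0\Leftrightarrow a\succ_l b$. An allocation is a bijection $x:N\to A$, $i\mapsto x_i$. It is Pareto-efficient if no allocation $y$ satisfies $y_i\succsim_i x_i$ for all $i$ and $y_i\succ_i x_i$ for some $i$. Allocation $x$ intensity-dominates allocation $y$ if for every pair of distinct agents $(i,j)$ such that $(x_i,x_j)=(y_j,y_i)=(a,b)$ it holds that $s_i(a,b)\ge s_j(a,b)$, with strict inequality for some such pair. The algorithm. Input: a strict intensity profile, given by $(s_1,\dots,s_n)$. Step 1: draw a linear order $\gg_1$ over $N$ uniformly at random. Step 2 (Random Priority): going through the agents in the order $\gg_1$, assign each agent their most preferred item among those not yet assigned; the result is a Pareto-efficient allocation $x$. Step 3: draw a linear order $\gg_2$ over $N$ uniformly at random. Step 4: let $i$ be the $\gg_2$-highest remaining agent. Searching from the $\gg_2$-lowest remaining agent upwards, look for the $\gg_2$-lowest remaining agent $j\ne i$ such that $s_i(x_j,x_i)>s_j(x_j,x_i)$. If such $j$ exists, swap the items $x_i$ and $x_j$ between $i$ and $j$, and remove agents $i,j$ and items $x_i,x_j$. If no such $j$ exists, remove agent $i$ and item $x_i$ (so $i$ keeps $x_i$). Repeat Step 4 until no agents remain. The steps counted are the pairwise searches in Step 4 (each being a test of the inequality $s_i(x_j,x_i)>s_j(x_j,x_i)$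 for one candidate $j$), summed over all repetitions; values of $s_l$ and preference lists are taken as available at unit cost. *)

theory Defs
  imports
    "HOL-Probability.Probability"
    "HOL-Combinatorics.Multiset_Permutations"
    "HOL-Library.Landau_Symbols"
begin

type_synonym 'a intensity = "'a \<times> 'a \<Rightarrow> 'a \<times> 'a \<Rightarrow> bool"

definition indifferent :: "'a intensity \<Rightarrow> 'a \<times> 'a \<Rightarrow> 'a \<times> 'a \<Rightarrow> bool" where
  "indifferent R p q \<longleftrightarrow> R p q \<and> R q p"

definition prefers :: "'a intensity \<Rightarrow> 'a \<Rightarrow> 'a \<Rightarrow> bool" where
  "prefers R a b \<longleftrightarrow> R (a, b) (b, a)"

definition strictly_prefers :: "'a intensity \<Rightarrow> 'a \<Rightarrow> 'a \<Rightarrow> bool" where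
  "strictly_prefers R a b \<longleftrightarrow> prefers R a b \<and> \<not> prefers R b a"

definition represents :: "'a set \<Rightarrow> 'a intensity \<Rightarrow> ('a \<Rightarrow> 'a \<Rightarrow> real) \<Rightarrow> bool" where
  "represents A R s \<longleftrightarrow>
     (\<forall>a\<in>A. \<forall>b\<in>A. \<forall>c\<in>A. \<forall>d\<in>A. \<forall>e\<in>A.
        (R (a, b) (c, d) \<longleftrightarrow> s a b \<ge> s c d) \<and>
        (R (a, b) (b, a) \<longleftrightarrow> s a b \<ge> s e e \<and> s e e \<ge> s b a) \<and>
        (min (s a b) (s b c) \<ge> s e e \<longrightarrow> s a c \<ge> max (s a b) (s b c)) \<and>
        (min (s a b) (s b c) > s e e \<longrightarrow> s a c > max (s a b) (s b c)) \<and>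
        (s a b \<ge> s c d \<longleftrightarrow> s d c \<ge> s b a))"

definition representable :: "'a set \<Rightarrow> 'a intensity \<Rightarrow> bool" where
  "representable A R \<longleftrightarrow> (\<exists>s. represents A R s)"

definition strict_intensity :: "'a set \<Rightarrow> 'a intensity \<Rightarrow> bool" where
  "strict_intensity A R \<longleftrightarrow>
     (\<forall>a\<in>A. \<forall>b\<in>A. \<forall>c\<in>A. \<forall>d\<in>A.
        (a, b) \<noteq> (c, d) \<and> a \<noteq> b \<and> c \<noteq> d \<longrightarrow> \<not> indifferent R (a, b) (c, d))"

definition strict_intensity_profile :: "nat \<Rightarrow> 'a set \<Rightarrow> (nat \<Rightarrow> 'a intensity) \<Rightarrow> bool" where
  "strict_intensity_profile n A R \<longleftrightarrow>
     finite A \<and> card A = n \<and> (\<forall>l\<in>{1..n}. representable A (R l) \<and> strict_intensity A (R l))"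

definition canonical_representation :: "'a set \<Rightarrow> 'a intensity \<Rightarrow> ('a \<Rightarrow> 'a \<Rightarrow> real) \<Rightarrow> bool" where
  "canonical_representation A R s \<longleftrightarrow>
     represents A R s \<and>
     (\<lambda>(a, b). s a b) ` (A \<times> A) = real_of_int ` {- int (card A choose 2) .. int (card A choose 2)}"

text \<open>
  The canonical representation is unique on \<open>A \<times> A\<close> only (values elsewhere are irrelevant),
  hence the choice operator; its existence is shown below.
\<close>

definition canonical_intensity :: "'a set \<Rightarrow> 'a intensity \<Rightarrow> 'a \<Rightarrow> 'a \<Rightarrow> real" where
  "canonical_intensity A R = (SOME s. canonical_representation A R s)"

lemma representsD:
  assumes "represents A R s" "a \<in> A" "b \<in> A"
  shows "c \<in> A \<Longrightarrow> d \<in> A \<Longrightarrow> R (a, b) (c, d) \<longleftrightarrow> s a b \<ge> s c d"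
    and "e \<in> A \<Longrightarrow> R (a, b) (b, a) \<longleftrightarrow> s a b \<ge> s e e \<and> s e e \<ge> s b a"
    and "c \<in> A \<Longrightarrow> e \<in> A \<Longrightarrow> min (s a b) (s b c) \<ge> s e e \<Longrightarrow> s a c \<ge> max (s a b) (s b c)"
    and "c \<in> A \<Longrightarrow> e \<in> A \<Longrightarrow> min (s a b) (s b c) > s e e \<Longrightarrow> s a c > max (s a b) (s b c)"
    and "c \<in> A \<Longrightarrow> d \<in> A \<Longrightarrow> s a b \<ge> s c d \<longleftrightarrow> s d c \<ge> s b a"
  using assms unfolding represents_def by blast+

lemma represents_strict_mono:
  assumes s: "represents A R s"
    and f: "strict_mono_on ((\<lambda>(a, b). s a b) ` (A \<times> A)) f"
  shows "represents A R (\<lambda>a b. f (s a b))"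
proof -
  let ?V = "(\<lambda>(a, b). s a b) ` (A \<times> A)"
  have V: "s a b \<in> ?V" if "a \<in> A" "b \<in> A" for a b
    using that by force
  have le: "f (s a b) \<le> f (s c d) \<longleftrightarrow> s a b \<le> s c d"
    if "a \<in> A" "b \<in> A" "c \<in> A" "d \<in> A" for a b c d
    using strict_mono_on_less_eq[OF f V V] that by blast
  have less: "f (s a b) < f (s c d) \<longleftrightarrow> s a b < s c d"
    if "a \<in> A" "b \<in> A" "c \<in> A" "d \<in> A" for a b c d
    using le[OF that(3,4,1,2)] by linarith
  show ?thesis
    unfolding represents_def
  proof (intro ballI)
    fix a b c d e assume "a \<in> A" "b \<in> A" "c \<in> A" "d \<in> A" "e \<in> A"
    then show "(R (a, b) (c, d) \<longleftrightarrow> f (s a b) \<ge> f (s c d)) \<and>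
        (R (a, b) (b, a) \<longleftrightarrow> f (s a b) \<ge> f (s e e) \<and> f (s e e) \<ge> f (s b a)) \<and>
        (min (f (s a b)) (f (s b c)) \<ge> f (s e e) \<longrightarrow> f (s a c) \<ge> max (f (s a b)) (f (s b c))) \<and>
        (min (f (s a b)) (f (s b c)) > f (s e e) \<longrightarrow> f (s a c) > max (f (s a b)) (f (s b c))) \<and>
        (f (s a b) \<ge> f (s c d) \<longleftrightarrow> f (s d c) \<ge> f (s b a))"
      using representsD(1,5)[OF s, of a b c d] representsD(2)[OF s, of a b e]
        representsD(3,4)[OF s, of a b c e]
      by (simp add: le less)
  qed
qed

lemma rank_image:
  fixes V :: "real set"
  assumes "finite V"
  shows "strict_mono_on V (\<lambda>v. card {w\<in>V. w < v})"
    and "(\<lambda>v. card {w\<in>V. w < v}) ` V = {..<card V}"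
proof -
  show mono: "strict_mono_on V (\<lambda>v. card {w\<in>V. w < v})"
  proof (rule strict_mono_onI)
    fix u v assume uv: "u \<in> V" "v \<in> V" "u < v"
    then have "{w\<in>V. w < u} \<subset> {w\<in>V. w < v}" by auto
    then show "card {w\<in>V. w < u} < card {w\<in>V. w < v}"
      using assms by (intro psubset_card_mono) auto
  qed
  show "(\<lambda>v. card {w\<in>V. w < v}) ` V = {..<card V}"
  proof (rule card_subset_eq)
    have "card {w\<in>V. w < v} < card V" if "v \<in> V" for v
      using assms that by (intro psubset_card_mono) auto
    then show "(\<lambda>v. card {w\<in>V. w < v}) ` V \<subseteq> {..<card V}" by blast
    show "card ((\<lambda>v. card {w\<in>V. w < v}) ` V) = card {..<card V}"
      using card_image[OF strict_mono_on_imp_inj_on[OF mono]] by simp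
  qed simp
qed

lemma card_range_representation:
  assumes A: "finite A" "A \<noteq> {}" and s: "represents A R s" and strict: "strict_intensity A R"
  shows "card ((\<lambda>(a, b). s a b) ` (A \<times> A)) = 2 * (card A choose 2) + 1"
proof -
  let ?s = "\<lambda>(a, b). s a b"
  obtain e where e: "e \<in> A" using A by blast
  let ?D = "(\<lambda>a. (a, a)) ` A"
  let ?O = "A \<times> A - ?D"
  have diag: "s a a = s e e" if "a \<in> A" for a
    using representsD(2)[OF s that that e] representsD(1)[OF s that that that that] by simp
  have inj: "inj_on ?s ?O"
  proof (rule inj_onI, clarify)
    fix a b c d
    assume *: "a \<in> A" "b \<in> A" "(a, b) \<notin> ?D" "c \<in> A" "d \<in> A" "(c, d) \<notin> ?D" "s a b = s c d"
    then have "indifferent R (a, b) (c, d)"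
      unfolding indifferent_def using representsD(1)[OF s] by simp
    then show "a = c \<and> b = d"
      using strict * unfolding strict_intensity_def by blast
  qed
  have notin: "s e e \<notin> ?s ` ?O"
  proof
    assume "s e e \<in> ?s ` ?O"
    then obtain a b where ab: "a \<in> A" "b \<in> A" "(a, b) \<notin> ?D" "s a b = s e e" by auto
    then have "s b a = s e e"
      using representsD(5)[OF s ab(1,2) e e] representsD(5)[OF s e e ab(1,2)] by simp
    then have "indifferent R (a, b) (b, a)"
      unfolding indifferent_def using representsD(1)[OF s] ab by simp
    moreover have "a \<noteq> b" using ab by blast
    ultimately show False
      using strict ab unfolding strict_intensity_def by blast
  qed
  have "A \<times> A = ?O \<union> ?D" by auto
  then have "?s ` (A \<times> A) = ?s ` ?O \<union> ?s ` ?D" by (metis image_Un)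
  also have "?s ` ?D = (\<lambda>a. s e e) ` A"
    unfolding image_image by (rule image_cong) (simp_all add: diag)
  also have "\<dots> = {s e e}" using e by blast
  finally have V: "?s ` (A \<times> A) = insert (s e e) (?s ` ?O)" by simp
  have "card ?O = card A * card A - card A"
    using A by (subst card_Diff_subset) (auto simp: card_cartesian_product card_image inj_on_def)
  also have "\<dots> = 2 * (card A choose 2)"
    using dvd_mult_div_cancel[of 2 "card A * (card A - 1)"]
    by (simp add: choose_two diff_mult_distrib2)
  finally show ?thesis
    unfolding V using notin inj A by (simp add: card_image)
qed

lemma canonical_representation_ex:
  assumes "finite A" "A \<noteq> {}" "representable A R" "strict_intensity A R"
  shows "\<exists>s. canonical_representation A R s"
proof -
  obtain s where s: "represents A R s"
    using assms(3) unfolding representable_def by blast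
  let ?V = "(\<lambda>(a, b). s a b) ` (A \<times> A)"
  let ?k = "card A choose 2"
  let ?r = "\<lambda>v. card {w\<in>?V. w < v}"
  let ?f = "\<lambda>v. real_of_int (int (?r v) - int ?k)"
  have fin: "finite ?V" using assms by simp
  have "strict_mono_on ?V ?f"
  proof (rule strict_mono_onI)
    fix u v assume "u \<in> ?V" "v \<in> ?V" "u < v"
    from strict_mono_onD[OF rank_image(1)[OF fin] this] show "?f u < ?f v" by linarith
  qed
  then have rep: "represents A R (\<lambda>a b. ?f (s a b))"
    by (rule represents_strict_mono[OF s])
  have "(\<lambda>(a, b). ?f (s a b)) ` (A \<times> A) = (\<lambda>m. real_of_int (int m - int ?k)) ` (?r ` ?V)"
    by (auto simp: image_image case_prod_unfold)
  also have "?r ` ?V = {..<2 * ?k + 1}"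
    using rank_image(2)[OF fin] card_range_representation[OF assms(1,2) s assms(4)] by simp
  also have "(\<lambda>m. real_of_int (int m - int ?k)) ` {..<2 * ?k + 1} =
      real_of_int ` ((\<lambda>m. int m - int ?k) ` {..<2 * ?k + 1})"
    by (simp add: image_image)
  also have "(\<lambda>m. int m - int ?k) ` {..<2 * ?k + 1} = {- int ?k .. int ?k}"
  proof (intro equalityI subsetI)
    fix z assume "z \<in> {- int ?k .. int ?k}"
    then have "z = int (nat (z + int ?k)) - int ?k" "nat (z + int ?k) \<in> {..<2 * ?k + 1}" by auto
    then show "z \<in> (\<lambda>m. int m - int ?k) ` {..<2 * ?k + 1}" by blast
  qed auto
  finally show ?thesis
    using rep unfolding canonical_representation_def by blast
qed

lemma canonical_intensity:
  assumes "finite A" "A \<noteq> {}" "representable A R" "strict_intensity A R"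
  shows "canonical_representation A R (canonical_intensity A R)"
  using someI_ex[OF canonical_representation_ex[OF assms]] unfolding canonical_intensity_def .

definition allocation :: "nat \<Rightarrow> 'a set \<Rightarrow> (nat \<Rightarrow> 'a) \<Rightarrow> bool" where
  "allocation n A x \<longleftrightarrow> bij_betw x {1..n} A"

definition pareto_efficient ::
    "nat \<Rightarrow> 'a set \<Rightarrow> (nat \<Rightarrow> 'a intensity) \<Rightarrow> (nat \<Rightarrow> 'a) \<Rightarrow> bool" where
  "pareto_efficient n A R x \<longleftrightarrow>
     allocation n A x \<and>
     \<not> (\<exists>y. allocation n A y \<and>
           (\<forall>i\<in>{1..n}. prefers (R i) (y i) (x i)) \<and>
           (\<exists>i\<in>{1..n}. strictly_prefers (R i) (y i) (x i)))"

definition intensity_dominates ::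
    "nat \<Rightarrow> (nat \<Rightarrow> 'a \<Rightarrow> 'a \<Rightarrow> real) \<Rightarrow> (nat \<Rightarrow> 'a) \<Rightarrow> (nat \<Rightarrow> 'a) \<Rightarrow> bool" where
  "intensity_dominates n s x y \<longleftrightarrow>
     (\<forall>i\<in>{1..n}. \<forall>j\<in>{1..n}. \<forall>a b.
        i \<noteq> j \<and> (x i, x j) = (a, b) \<and> (y j, y i) = (a, b) \<longrightarrow> s i a b \<ge> s j a b) \<and>
     (\<exists>i\<in>{1..n}. \<exists>j\<in>{1..n}. \<exists>a b.
        i \<noteq> j \<and> (x i, x j) = (a, b) \<and> (y j, y i) = (a, b) \<and> s i a b > s j a b)"

text \<open>
  A linear order over the agents is the list of all agents, highest first.
\<close>

definition most_preferred :: "'a intensity \<Rightarrow> 'a set \<Rightarrow> 'a" where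
  "most_preferred R B = (THE a. a \<in> B \<and> (\<forall>b\<in>B. prefers R a b))"

text \<open>
  \<open>random_priority A R order B x\<close> continues the partial assignment \<open>x\<close>, where \<open>B\<close> is the set of
  items not yet assigned. The second component is the number of preference list entries read: an
  agent receiving \<open>a\<close> reads the list down to the position of \<open>a\<close>, which is its first unassigned entry.
\<close>

fun random_priority ::
    "'a set \<Rightarrow> (nat \<Rightarrow> 'a intensity) \<Rightarrow> nat list \<Rightarrow> 'a set \<Rightarrow> (nat \<Rightarrow> 'a) \<Rightarrow> (nat \<Rightarrow> 'a) \<times> nat" where
  "random_priority A R [] B x = (x, 0)"
| "random_priority A R (i # is) B x =
     (let a = most_preferred (R i) B;
          (x', t) = random_priority A R is (B - {a}) (x(i := a))
      in (x', card {b\<in>A. prefers (R i) b a} + t))"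

text \<open>The first list element passing the test, and the number of elements tested.\<close>

fun search :: "('b \<Rightarrow> bool) \<Rightarrow> 'b list \<Rightarrow> 'b option \<times> nat" where
  "search P [] = (None, 0)"
| "search P (j # js) =
     (if P j then (Some j, 1) else let (r, c) = search P js in (r, c + 1))"

lemma search_Some: "search P js = (Some j, c) \<Longrightarrow> j \<in> set js \<and> P j"
  by (induction js arbitrary: c) (auto split: if_splits prod.splits)

text \<open>
  Step 4, repeated until no agents remain. The list contains the remaining agents, highest first;
  the remaining items are those held by them. The result consists of the final allocation, the
  number of pairwise searches and the number of repetitions.
\<close>

function swap_phase ::
    "(nat \<Rightarrow> 'a \<Rightarrow> 'a \<Rightarrow> real) \<Rightarrow> nat list \<Rightarrow> (nat \<Rightarrow> 'a) \<Rightarrow> (nat \<Rightarrow> 'a) \<times> nat \<times> nat" where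
  "swap_phase s [] x = (x, 0, 0)"
| "swap_phase s (i # is) x =
     (case search (\<lambda>j. s i (x j) (x i) > s j (x j) (x i)) (rev is) of
        (None, c) \<Rightarrow>
          (let (z, c', m) = swap_phase s is x in (z, c + c', m + 1))
      | (Some j, c) \<Rightarrow>
          (let (z, c', m) = swap_phase s (remove1 j is) (x(i := x j, j := x i))
           in (z, c + c', m + 1)))"
  by pat_completeness auto
termination
  by (relation "Wellfounded.measure (\<lambda>(s, is, x). length is)")
     (auto simp: length_remove1)

record 'a run =
  rp_allocation :: "nat \<Rightarrow> 'a"
  final_allocation :: "nat \<Rightarrow> 'a"
  searches :: nat
  running_time :: nat

text \<open>
  The running time charges one unit for each entry of the two orders drawn, each preference list
  entry read, each pairwise search and each repetition of Step 4 (swap and removal).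
\<close>

definition extended_random_priority ::
    "nat \<Rightarrow> 'a set \<Rightarrow> (nat \<Rightarrow> 'a intensity) \<Rightarrow> 'a run pmf" where
  "extended_random_priority n A R =
     do {
       order1 \<leftarrow> pmf_of_set (permutations_of_set {1..n});
       let (x, t) = random_priority A R order1 A (\<lambda>_. undefined);
       order2 \<leftarrow> pmf_of_set (permutations_of_set {1..n});
       let (z, c, m) = swap_phase (\<lambda>l. canonical_intensity A (R l)) order2 x;
       return_pmf
         \<lparr> rp_allocation = x, final_allocation = z, searches = c,
           running_time = length order1 + t + length order2 + c + m \<rparr>
     }"

end

theory Submission
  imports Defs
begin

text \<open>
  In the order of the draw, each agent holds under the Random Priority allocation \<open>x\<close> the unique
  best item among those left by the predecessors, so inductively an allocation that is weakly better
  for everybody agrees with \<open>x\<close>.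

  In Step 4 an agent takes part in at most one swap, since both partners leave, so the final
  allocation arises from \<open>x\<close> by swaps of disjoint pairs \<open>{i, j}\<close>, where
  \<open>s\<^sub>i(x\<^sub>j, x\<^sub>i) > s\<^sub>j(x\<^sub>j, x\<^sub>i)\<close>. As a canonical representation is skew-symmetric, this inequality is
  the one for the ordered pair \<open>(j, i)\<close> as well. Each repetition searches the
  remaining agents at most once, which gives \<open>(n - 1) + (n - 2) + \<dots> + 0\<close> searches.
\<close>

section \<open>Skew-symmetry of the canonical representation\<close>

text \<open>The least point that \<open>f\<close> moves down would be sent to a smaller point that
  \<open>f\<close> also moves down; dually for the greatest point moved up.\<close>

lemma strict_mono_on_finite_self_map:
  fixes f :: "'b::linorder \<Rightarrow> 'b"
  assumes "finite V" "strict_mono_on V f" "f ` V \<subseteq> V" "v \<in> V"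
  shows "f v = v"
proof (rule ccontr)
  assume "f v \<noteq> v"
  then consider "f v < v" | "v < f v" by fastforce
  then show False
  proof cases
    case 1
    let ?L = "{w \<in> V. f w < w}"
    have L: "finite ?L" "v \<in> ?L" using assms 1 by auto
    then have m: "Min ?L \<in> ?L" by (metis Min_in empty_iff)
    then have "f (Min ?L) \<in> ?L"
      using assms(3) strict_mono_onD[OF assms(2)] by blast
    then show False using Min_le[OF L(1)] m by fastforce
  next
    case 2
    let ?L = "{w \<in> V. w < f w}"
    have L: "finite ?L" "v \<in> ?L" using assms 2 by auto
    then have m: "Max ?L \<in> ?L" by (metis Max_in empty_iff)
    then have "f (Max ?L) \<in> ?L"
      using assms(3) strict_mono_onD[OF assms(2)] by blast
    then show False using Max_ge[OF L(1)] m by fastforce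
  qed
qed

text \<open>
  By reversal, \<open>s c d \<mapsto> - s d c\<close> is a well-defined increasing map of the finite symmetric range into
  itself, hence the identity.
\<close>

lemma canonical_representation_skew:
  assumes s: "canonical_representation A R s" and ab: "a \<in> A" "b \<in> A"
  shows "s b a = - s a b"
proof -
  let ?k = "int (card A choose 2)"
  define V where "V = (\<lambda>(a, b). s a b) ` (A \<times> A)"
  have rep: "represents A R s" and V: "V = real_of_int ` {- ?k .. ?k}"
    using s unfolding canonical_representation_def V_def by auto
  have rev: "s c d \<le> s a b \<longleftrightarrow> s b a \<le> s d c" if "a \<in> A" "b \<in> A" "c \<in> A" "d \<in> A" for a b c d
    using representsD(5)[OF rep] that by blast
  have VI: "s c d \<in> V" if "c \<in> A" "d \<in> A" for c d
    using that unfolding V_def by force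
  have neg: "- v \<in> V" if v: "v \<in> V" for v
  proof -
    obtain m where "v = real_of_int m" "m \<in> {- ?k .. ?k}" using v unfolding V by blast
    then have "- v = real_of_int (- m)" "- m \<in> {- ?k .. ?k}" by auto
    then show ?thesis unfolding V by blast
  qed
  \<comment> \<open>By reversal, pairs with equal values have reversed pairs with equal values, so
    this description is unique on the range.\<close>
  define f where "f v = (THE w. \<exists>c\<in>A. \<exists>d\<in>A. v = s c d \<and> w = - s d c)" for v
  have f: "f (s c d) = - s d c" if "c \<in> A" "d \<in> A" for c d
    unfolding f_def
  proof (rule the_equality)
    fix w assume "\<exists>c'\<in>A. \<exists>d'\<in>A. s c d = s c' d' \<and> w = - s d' c'"
    then obtain c' d' where "c' \<in> A" "d' \<in> A" "s c d = s c' d'" "w = - s d' c'" by blast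
    then show "w = - s d c" using rev[of c d c' d'] rev[of c' d' c d] that by simp
  qed (use that in blast)
  have "strict_mono_on V f"
  proof (rule strict_mono_onI)
    fix v w assume "v \<in> V" "w \<in> V" "v < w"
    then obtain c d c' d' where "c \<in> A" "d \<in> A" "v = s c d" "c' \<in> A" "d' \<in> A" "w = s c' d'"
      unfolding V_def by auto
    then show "f v < f w" using f rev[of c d c' d'] \<open>v < w\<close> by (simp add: not_le[symmetric])
  qed
  \<comment> \<open>The canonical range is symmetric about 0, so negated values stay in
    \<open>V\<close>.\<close>
  moreover have "f ` V \<subseteq> V" using f VI neg unfolding V_def by fastforce
  moreover have "finite V" unfolding V by simp
  ultimately have "f (s a b) = s a b"
    using VI[OF ab] strict_mono_on_finite_self_map by blast
  then show ?thesis using f[OF ab] by simp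
qed

section \<open>Induced linear preferences and Random Priority\<close>

text \<open>Abstracts from intensities: the analysis of Random Priority rests on these order
  properties alone.\<close>

definition linear_preference :: "'a set \<Rightarrow> 'a intensity \<Rightarrow> bool" where
  "linear_preference A R \<longleftrightarrow>
     (\<forall>a\<in>A. \<forall>b\<in>A. prefers R a b \<or> prefers R b a) \<and>
     (\<forall>a\<in>A. \<forall>b\<in>A. prefers R a b \<and> prefers R b a \<longrightarrow> a = b) \<and>
     (\<forall>a\<in>A. \<forall>b\<in>A. \<forall>c\<in>A. prefers R a b \<and> prefers R b c \<longrightarrow> prefers R a c)"

text \<open>Antisymmetry is strictness for the pairs \<open>(a, b)\<close> and
  \<open>(b, a)\<close>; transitivity is condition (iii) with reference value \<open>s a a\<close>;
  totality compares \<open>s a b\<close> with \<open>s b a\<close> in the reals.\<close>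

lemma linear_preference_strict_intensity:
  assumes "representable A R" "strict_intensity A R"
  shows "linear_preference A R"
proof -
  obtain s where s: "represents A R s" using assms(1) unfolding representable_def by blast
  have iff: "prefers R a b \<longleftrightarrow> s b a \<le> s a b" if "a \<in> A" "b \<in> A" for a b
    using representsD(1)[OF s that that(2,1)] unfolding prefers_def .
  have iff0: "prefers R a b \<longleftrightarrow> s a a \<le> s a b \<and> s b a \<le> s a a" if "a \<in> A" "b \<in> A" for a b
    using representsD(2)[OF s that that(1)] unfolding prefers_def .
  have "a = b" if ab: "a \<in> A" "b \<in> A" "prefers R a b" "prefers R b a" for a b
    using assms(2)[unfolded strict_intensity_def, rule_format, OF ab(1,2) ab(2,1)] ab(3,4)
    unfolding indifferent_def prefers_def by auto
  moreover have "prefers R a c"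
    if A: "a \<in> A" "b \<in> A" "c \<in> A" and "prefers R a b" "prefers R b c" for a b c
  proof -
    have "min (s a b) (s b c) \<ge> s a a"
      using that representsD(2)[OF s A(2,3,1)] iff0[OF A(1,2)] unfolding prefers_def by simp
    then have "s a a \<le> s a c"
      using representsD(3)[OF s A A(1)] by simp
    \<comment> \<open>Reversal turns \<open>s a a \<le> s a c\<close> into
      \<open>s c a \<le> s a a\<close>, the other half of \<open>iff0\<close>.\<close>
    then show ?thesis
      using iff0[OF A(1,3)] representsD(5)[OF s A(1,3,1,1)] by simp
  qed
  moreover have "prefers R a b \<or> prefers R b a" if "a \<in> A" "b \<in> A" for a b
    using iff[OF that] iff[OF that(2,1)] by linarith
  ultimately show ?thesis unfolding linear_preference_def by blast
qed

lemma linear_preferenceD: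
  assumes "linear_preference A R" "a \<in> A" "b \<in> A"
  shows "prefers R a b \<or> prefers R b a"
    and "prefers R a b \<Longrightarrow> prefers R b a \<Longrightarrow> a = b"
    and "c \<in> A \<Longrightarrow> prefers R a b \<Longrightarrow> prefers R b c \<Longrightarrow> prefers R a c"
  using assms unfolding linear_preference_def by blast+

text \<open>Makes the definite description meaningful: a best item of a finite nonempty set exists
  by induction, and antisymmetry makes it unique.\<close>

lemma most_preferred:
  assumes R: "linear_preference A R" and B: "finite B" "B \<noteq> {}" "B \<subseteq> A"
  shows "most_preferred R B \<in> B" and "\<And>b. b \<in> B \<Longrightarrow> prefers R (most_preferred R B) b"
proof -
  have "\<exists>a\<in>B. \<forall>b\<in>B. prefers R a b"
    using B
  proof (induction rule: finite_ne_induct)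
    case (singleton a)
    then show ?case using linear_preferenceD(1)[OF R, of a a] by blast
  next
    case (insert c B)
    then obtain a where a: "a \<in> B" "\<forall>b\<in>B. prefers R a b" by auto
    have A: "a \<in> A" "c \<in> A" "B \<subseteq> A" using a insert by auto
    show ?case
    proof (cases "prefers R a c")
      case True
      then show ?thesis using a by blast
    next
      case False
      then have "prefers R c a" using linear_preferenceD(1)[OF R A(1,2)] by blast
      then have "\<forall>b\<in>B. prefers R c b"
        using a(2) linear_preferenceD(3)[OF R A(2,1)] A(3) by blast
      moreover have "prefers R c c" using linear_preferenceD(1)[OF R A(2,2)] by blast
      ultimately show ?thesis by blast
    qed
  qed
  then have "\<exists>!a. a \<in> B \<and> (\<forall>b\<in>B. prefers R a b)"
    using linear_preferenceD(2)[OF R] B(3) by blast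
  from theI'[OF this] show "most_preferred R B \<in> B"
    and "\<And>b. b \<in> B \<Longrightarrow> prefers R (most_preferred R B) b"
    unfolding most_preferred_def by blast+
qed

text \<open>The first agent \<open>i\<close> gets the best item \<open>a\<close> of
  \<open>B\<close>. A weakly better \<open>y\<close> also takes \<open>y i\<close> from
  \<open>B\<close>, so antisymmetry forces \<open>y i = a\<close>, and deleting \<open>i\<close> and
  \<open>a\<close> reduces the claim to the later agents. Each agent reads at most
  \<open>card A\<close> list entries.\<close>

lemma random_priority:
  assumes "random_priority A R is B x = (x', t)"
    and "finite A" "B \<subseteq> A" "distinct is" "card B = length is"
    and "\<forall>i\<in>set is. linear_preference A (R i)"
  shows "bij_betw x' (set is) B"
    and "t \<le> length is * card A"
    and "\<And>y i. bij_betw y (set is) B \<Longrightarrow> \<forall>i\<in>set is. prefers (R i) (y i) (x' i) \<Longrightarrow>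
           i \<in> set is \<Longrightarrow> y i = x' i"
proof -
  \<comment> \<open>The clause on agents outside the list strengthens the induction: it keeps the
    head's item fixed while the tail is served.\<close>
  have H: "(\<forall>k. k \<notin> set is \<longrightarrow> x' k = x k) \<and> bij_betw x' (set is) B \<and> t \<le> length is * card A \<and>
    (\<forall>y. bij_betw y (set is) B \<and> (\<forall>i\<in>set is. prefers (R i) (y i) (x' i)) \<longrightarrow>
       (\<forall>i\<in>set is. y i = x' i))"
    using assms
  proof (induction "is" arbitrary: B x x' t)
    case Nil
    then show ?case using finite_subset[OF Nil.prems(3,2)] by (auto simp: bij_betw_def)
  next
    case (Cons i js)
    define a where "a = most_preferred (R i) B"
    obtain t' where t': "random_priority A R js (B - {a}) (x(i := a)) = (x', t')"
      and t: "t = card {b\<in>A. prefers (R i) b a} + t'"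
      using Cons.prems(1) by (auto simp: a_def Let_def split: prod.splits)
    have B: "finite B" "B \<noteq> {}" using Cons.prems(2,3,5) finite_subset by auto
    have lin: "linear_preference A (R i)" using Cons.prems(6) by simp
    have a: "a \<in> B" "\<And>b. b \<in> B \<Longrightarrow> prefers (R i) a b"
      using most_preferred[OF lin B Cons.prems(3)] unfolding a_def by blast+
    have sub: "B - {a} \<subseteq> A" and dist: "distinct js" using Cons.prems by auto
    have lin': "\<forall>k\<in>set js. linear_preference A (R k)" using Cons.prems(6) by simp
    have "card (B - {a}) = length js" using Cons.prems(5) a(1) B by simp
    note H = Cons.IH[OF t' Cons.prems(2) sub dist this lin']
    note IH1 = H[THEN conjunct1, THEN spec, THEN mp]
      and IH2 = H[THEN conjunct2, THEN conjunct1]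
      and IH3 = H[THEN conjunct2, THEN conjunct2, THEN conjunct1]
      and IH4 = H[THEN conjunct2, THEN conjunct2, THEN conjunct2, THEN spec, THEN mp,
        OF conjI, THEN bspec]
    have i: "i \<notin> set js" using Cons.prems(4) by simp
    then have x'i: "x' i = a" using IH1[of i] by simp
    have "bij_betw x' (insert i (set js)) (insert a (B - {a}))"
      using notIn_Un_bij_betw[OF i _ IH2] x'i by simp
    then have bij: "bij_betw x' (set (i # js)) B" using a(1) by (simp add: insert_absorb)
    have "card {b\<in>A. prefers (R i) b a} \<le> card A"
      using Cons.prems(2) by (intro card_mono) auto
    then have time: "t \<le> length (i # js) * card A" using t IH3 by simp
    have "y k = x' k"
      if y: "bij_betw y (set (i # js)) B" "\<forall>k\<in>set (i # js). prefers (R k) (y k) (x' k)"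
        and k: "k \<in> set (i # js)" for y k
    proof -
      have yi: "y i \<in> B" using y(1) bij_betwE by fastforce
      have ya: "y i = a"
        using linear_preferenceD(2)[OF lin _ _ _ a(2)[OF yi]] y(2) x'i yi a(1) Cons.prems(3) by auto
      have "bij_betw y (set (i # js) - {i}) (B - {y i})"
        by (rule bij_betw_DiffI[OF y(1) bij_betw_singletonI[OF refl]]) (simp_all add: yi)
      then have "bij_betw y (set js) (B - {a})" using i ya by simp
      then show ?thesis using IH4[of y k] y(2) k ya x'i by (cases "k = i") auto
    qed
    moreover have "x' k = x k" if "k \<notin> set (i # js)" for k using IH1[of k] that by simp
    ultimately show ?case using bij time by blast
  qed
  show "bij_betw x' (set is) B" "t \<le> length is * card A"
    using H by simp_all
  show "\<And>y i. bij_betw y (set is) B \<Longrightarrow> \<forall>i\<in>set is. prefers (R i) (y i) (x' i) \<Longrightarrow>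
      i \<in> set is \<Longrightarrow> y i = x' i"
    by (rule H[THEN conjunct2, THEN conjunct2, THEN conjunct2, THEN spec, THEN mp,
          OF conjI, THEN bspec])
qed

section \<open>Counting searches and tracing swaps in Step 4\<close>

lemma search_count: "search P js = (r, c) \<Longrightarrow> c \<le> length js"
  by (induction js arbitrary: r c) (auto split: if_splits prod.splits)

text \<open>A repetition tests at most the tail of the list, and a swap shortens the list further;
  Pascal's rule then adds up the bounds.\<close>

lemma swap_phase_count:
  assumes "swap_phase s is x = (z, c, m)"
  shows "c \<le> length is choose 2" and "m \<le> length is"
proof -
  have "c \<le> length is choose 2 \<and> m \<le> length is"
    using assms
  proof (induction s "is" x arbitrary: z c m rule: swap_phase.induct)
    case (1 s x)
    then show ?case by simp
  next
    case (2 s i js x)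
    obtain r d where S: "search (\<lambda>j. s i (x j) (x i) > s j (x j) (x i)) (rev js) = (r, d)"
      by fastforce
    have d: "d \<le> length js" using search_count[OF S] by simp
    have choose: "Suc (length js) choose 2 = length js + (length js choose 2)"
      by (simp add: numeral_2_eq_2)
    show ?case
    proof (cases r)
      case None
      obtain c' m' where "swap_phase s js x = (z, c', m')" "c = d + c'" "m = m' + 1"
        using 2(3) S None by (auto split: prod.splits)
      then show ?thesis using 2(1)[OF S[symmetric] None] d choose by fastforce
    next
      case (Some j)
      then obtain c' m' where sw: "swap_phase s (remove1 j js) (x(i := x j, j := x i)) = (z, c', m')"
        "c = d + c'" "m = m' + 1"
        using 2(3) S by (auto split: prod.splits)
      have "c' \<le> length (remove1 j js) choose 2" "m' \<le> length (remove1 j js)"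
        using 2(2)[OF S[symmetric] Some sw(1)] by auto
      moreover have le: "length (remove1 j js) \<le> length js" by (simp add: length_remove1)
      moreover have "length (remove1 j js) choose 2 \<le> length js choose 2"
        using binomial_right_mono[OF le] .
      ultimately show ?thesis using sw d choose by simp
    qed
  qed
  then show "c \<le> length is choose 2" "m \<le> length is" by auto
qed

text \<open>Removed agents are never touched again; this freezes the items of both partners right
  after their swap.\<close>

lemma swap_phase_outside:
  "swap_phase s is x = (z, c, m) \<Longrightarrow> k \<notin> set is \<Longrightarrow> z k = x k"
proof (induction s "is" x arbitrary: z c m rule: swap_phase.induct)
  case (1 s x)
  then show ?case by simp
next
  case (2 s i js x)
  obtain r d where S: "search (\<lambda>j. s i (x j) (x i) > s j (x j) (x i)) (rev js) = (r, d)"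
    by fastforce
  show ?case
  proof (cases r)
    case None
    then obtain c' m' where "swap_phase s js x = (z, c', m')"
      using 2(3) S by (auto split: prod.splits)
    then show ?thesis using 2(1)[OF S[symmetric] None] 2(4) by auto
  next
    case (Some j)
    then obtain c' m' where "swap_phase s (remove1 j js) (x(i := x j, j := x i)) = (z, c', m')"
      using 2(3) S by (auto split: prod.splits)
    moreover have "j \<in> set js" using search_Some S Some by fastforce
    moreover have "k \<notin> set (remove1 j js)" using 2(4) set_remove1_subset by fastforce
    ultimately show ?thesis using 2(2)[OF S[symmetric] Some] 2(4) by fastforce
  qed
qed

text \<open>\<open>N\<close> stays fixed while the list shrinks, as the bijection must also cover
  the agents already removed. A swap composes \<open>x\<close> with a transposition.\<close>

lemma swap_phase_bij_betw:
  "swap_phase s is x = (z, c, m) \<Longrightarrow> set is \<subseteq> N \<Longrightarrow> bij_betw x N A \<Longrightarrow> bij_betw z N A"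
proof (induction s "is" x arbitrary: z c m rule: swap_phase.induct)
  case (1 s x)
  then show ?case by simp
next
  case (2 s i js x)
  obtain r d where S: "search (\<lambda>j. s i (x j) (x i) > s j (x j) (x i)) (rev js) = (r, d)"
    by fastforce
  show ?case
  proof (cases r)
    case None
    then obtain c' m' where "swap_phase s js x = (z, c', m')"
      using 2(3) S by (auto split: prod.splits)
    then show ?thesis using 2(1)[OF S[symmetric] None] 2(4,5) by auto
  next
    case (Some j)
    then obtain c' m' where sw: "swap_phase s (remove1 j js) (x(i := x j, j := x i)) = (z, c', m')"
      using 2(3) S by (auto split: prod.splits)
    have "j \<in> set js" using search_Some S Some by fastforce
    then have ij: "i \<in> N" "j \<in> N" using 2(4) by auto
    have "x(i := x j, j := x i) = x \<circ> Transposition.transpose i j"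
      by (auto simp: fun_eq_iff Transposition.transpose_def)
    then have "bij_betw (x(i := x j, j := x i)) N A"
      using bij_betw_swap_iff[OF ij, THEN iffD2, OF 2(5)] by simp
    moreover have "set (remove1 j js) \<subseteq> N" using 2(4) set_remove1_subset by fastforce
    ultimately show ?thesis using 2(2)[OF S[symmetric] Some sw] by blast
  qed
qed

text \<open>\<open>k\<close> may be the searching agent or the one found, hence the disjunction; the
  two cases exchange the roles of \<open>k\<close> and \<open>l\<close>.\<close>

lemma swap_phase_swaps:
  assumes "swap_phase s is x = (z, c, m)" "distinct is" "z k \<noteq> x k"
  shows "\<exists>l\<in>set is. l \<noteq> k \<and> z k = x l \<and> z l = x k \<and>
           (s k (x l) (x k) > s l (x l) (x k) \<or> s l (x k) (x l) > s k (x k) (x l))"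
  using assms
proof (induction s "is" x arbitrary: z c m rule: swap_phase.induct)
  case (1 s x)
  then show ?case by simp
next
  case (2 s i js x)
  obtain r d where S: "search (\<lambda>j. s i (x j) (x i) > s j (x j) (x i)) (rev js) = (r, d)"
    by fastforce
  show ?case
  proof (cases r)
    case None
    then obtain c' m' where "swap_phase s js x = (z, c', m')"
      using 2(3) S by (auto split: prod.splits)
    then show ?thesis using 2(1)[OF S[symmetric] None] 2(4,5) by auto
  next
    case (Some j)
    let ?x = "x(i := x j, j := x i)"
    obtain c' m' where sw: "swap_phase s (remove1 j js) ?x = (z, c', m')"
      using 2(3) S Some by (auto split: prod.splits)
    have j: "j \<in> set js" "s i (x j) (x i) > s j (x j) (x i)" using search_Some S Some by fastforce+
    \<comment> \<open>Distinctness makes \<open>remove1\<close> delete the only occurrence of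
      \<open>j\<close>, so neither partner is left in the list.\<close>
    have ij: "i \<noteq> j" and i: "i \<notin> set (remove1 j js)" and notj: "j \<notin> set (remove1 j js)"
      and dist: "distinct (remove1 j js)"
      using j 2(4) by auto
    have z: "z i = x j" "z j = x i"
      using swap_phase_outside[OF sw i] swap_phase_outside[OF sw notj] ij by auto
    consider "k = i" | "k = j" | "k \<noteq> i" "k \<noteq> j" by blast
    then show ?thesis
    proof cases
      case 1
      then show ?thesis using z j ij by auto
    next
      case 2
      then show ?thesis using z j ij by auto
    next
      case 3
      then have "z k \<noteq> ?x k" using 2(5) by simp
      then obtain l where l: "l \<in> set (remove1 j js)" "l \<noteq> k" "z k = ?x l" "z l = ?x k"
        "s k (?x l) (?x k) > s l (?x l) (?x k) \<or> s l (?x k) (?x l) > s k (?x k) (?x l)"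
        using 2(2)[OF S[symmetric] Some sw dist] by blast
      \<comment> \<open>Both \<open>k\<close> and \<open>l\<close> avoid the swapped agents, so
        \<open>?x\<close> and \<open>x\<close> agree on them and the claim for \<open>?x\<close>
        carries over to \<open>x\<close>.\<close>
      moreover have "l \<noteq> i" "l \<noteq> j" using l(1) i notj by auto
      moreover have "l \<in> set js" using l(1) notin_set_remove1 by metis
      ultimately show ?thesis using 3 by auto
    qed
  qed
qed

text \<open>By skew-symmetry it does not matter which partner searched, so every moved agent
  strictly wins the comparison with its partner. Any single moved agent supplies the strict
  pair.\<close>

lemma swap_phase_dominates:
  assumes sw: "swap_phase s is x = (z, c, m)" and "is": "distinct is" "set is = {1..n}"
    and x: "bij_betw x {1..n} A"
    and skew: "\<And>l a b. l \<in> {1..n} \<Longrightarrow> a \<in> A \<Longrightarrow> b \<in> A \<Longrightarrow> s l b a = - s l a b"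
  shows "z = x \<or> intensity_dominates n s z x"
proof (cases "z = x")
  case False
  \<comment> \<open>Reversing the item pair negates both sides of the second disjunct, which becomes
    the first.\<close>
  have pair: "s k (x l) (x k) > s l (x l) (x k)"
    if kl: "k \<in> {1..n}" "l \<in> {1..n}"
      and "s k (x l) (x k) > s l (x l) (x k) \<or> s l (x k) (x l) > s k (x k) (x l)" for k l
  proof -
    have "x k \<in> A" "x l \<in> A" using kl x bij_betwE by blast+
    then show ?thesis using that(3) skew[of k "x l" "x k"] skew[of l "x l" "x k"] kl by auto
  qed
  obtain k where k: "z k \<noteq> x k" using False by blast
  then have kn: "k \<in> {1..n}" using swap_phase_outside[OF sw] "is"(2) by blast
  then obtain l where l: "l \<in> {1..n}" "k \<noteq> l" "z k = x l" "z l = x k"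
    "s k (x l) (x k) > s l (x l) (x k)"
    using swap_phase_swaps[OF sw "is"(1) k] pair "is"(2) by metis
  have "s i (x j) (x i) > s j (x j) (x i)"
    if ij: "i \<in> {1..n}" "j \<in> {1..n}" "i \<noteq> j" "z i = x j" for i j
  proof -
    have inj: "inj_on x {1..n}" using x by (simp add: bij_betw_def)
    then have "z i \<noteq> x i" using ij by (metis inj_onD)
    from swap_phase_swaps[OF sw "is"(1) this] obtain l where l: "l \<in> {1..n}" "z i = x l"
      "s i (x l) (x i) > s l (x l) (x i) \<or> s l (x i) (x l) > s i (x i) (x l)"
      unfolding "is"(2) by blast
    \<comment> \<open>Two agents cannot hold the same item under \<open>x\<close>, so the swap
      partner \<open>l\<close> is the given \<open>j\<close>.\<close>
    then have "l = j" using ij inj by (metis inj_onD)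
    then show ?thesis using l pair ij by blast
  qed
  then have "\<forall>i\<in>{1..n}. \<forall>j\<in>{1..n}. \<forall>a b.
      i \<noteq> j \<and> (z i, z j) = (a, b) \<and> (x j, x i) = (a, b) \<longrightarrow> s i a b \<ge> s j a b"
    by (metis less_imp_le prod.inject)
  then show ?thesis
    unfolding intensity_dominates_def using kn l by blast
qed simp

section \<open>Guarantees for every realization of the algorithm\<close>

text \<open>An allocation weakly better for everybody agrees with \<open>x\<close> on all agents, so
  nobody can gain strictly.\<close>

lemma pareto_efficient_random_priority:
  assumes R: "strict_intensity_profile n A R"
    and is': "distinct is" "set is = {1..n}"
    and rp: "random_priority A R is A x0 = (x, t)"
  shows "pareto_efficient n A R x" and "t \<le> n * n"
proof -
  have A: "finite A" "card A = n" and len: "length is = n"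
    using R distinct_card[OF is'(1)] is'(2) unfolding strict_intensity_profile_def by auto
  have lin: "\<forall>i\<in>set is. linear_preference A (R i)"
    using R is'(2) linear_preference_strict_intensity
    unfolding strict_intensity_profile_def by blast
  note * = random_priority[OF rp A(1) order.refl is'(1) _ lin, unfolded len A(2) is'(2), OF refl]
  show "t \<le> n * n" using *(2) by blast
  show "pareto_efficient n A R x"
    unfolding pareto_efficient_def allocation_def strictly_prefers_def
    using *(1,3) by metis
qed

text \<open>Reduces claims about every outcome of positive probability to two arbitrary permutations
  followed by deterministic computations.\<close>

lemma set_pmf_extended_random_priority:
  assumes "r \<in> set_pmf (extended_random_priority n A R)"
  obtains order1 x t order2 z c m where
    "order1 \<in> permutations_of_set {1..n}" "order2 \<in> permutations_of_set {1..n}"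
    "random_priority A R order1 A (\<lambda>_. undefined) = (x, t)"
    "swap_phase (\<lambda>l. canonical_intensity A (R l)) order2 x = (z, c, m)"
    "r = \<lparr> rp_allocation = x, final_allocation = z, searches = c,
           running_time = length order1 + t + length order2 + c + m \<rparr>"
proof -
  have set_orders: "set_pmf (pmf_of_set (permutations_of_set {1..n})) = permutations_of_set {1..n}"
    by (simp add: set_pmf_of_set permutations_of_set_empty_iff)
  obtain order1 where o1: "order1 \<in> permutations_of_set {1..n}"
    and r1: "r \<in> set_pmf (let (x, t) = random_priority A R order1 A (\<lambda>_. undefined) in
      pmf_of_set (permutations_of_set {1..n}) \<bind> (\<lambda>order2.
        let (z, c, m) = swap_phase (\<lambda>l. canonical_intensity A (R l)) order2 x in
          return_pmf \<lparr> rp_allocation = x, final_allocation = z, searches = c,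
            running_time = length order1 + t + length order2 + c + m \<rparr>))"
    using assms unfolding extended_random_priority_def set_bind_pmf set_orders by blast
  obtain x t where rp: "random_priority A R order1 A (\<lambda>_. undefined) = (x, t)" by fastforce
  obtain order2 where o2: "order2 \<in> permutations_of_set {1..n}"
    and r2: "r \<in> set_pmf (let (z, c, m) = swap_phase (\<lambda>l. canonical_intensity A (R l)) order2 x in
          return_pmf \<lparr> rp_allocation = x, final_allocation = z, searches = c,
            running_time = length order1 + t + length order2 + c + m \<rparr>)"
    using r1 unfolding rp Let_def prod.case set_bind_pmf set_orders by blast
  obtain z c m where "swap_phase (\<lambda>l. canonical_intensity A (R l)) order2 x = (z, c, m)"
    by (metis prod_cases3)
  with o1 o2 rp r2 show thesis by (intro that) simp_all
qed

lemma extended_random_priority_run: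
  assumes R: "strict_intensity_profile n A R"
    and r: "r \<in> set_pmf (extended_random_priority n A R)"
  shows "searches r \<le> n choose 2"
    and "pareto_efficient n A R (rp_allocation r)"
    and "allocation n A (final_allocation r)"
    and "final_allocation r = rp_allocation r \<or>
         intensity_dominates n (\<lambda>l. canonical_intensity A (R l)) (final_allocation r) (rp_allocation r)"
    and "running_time r \<le> 2 * n ^ 2 + 3 * n"
proof -
  from r obtain order1 x t order2 z c m where
    ord: "order1 \<in> permutations_of_set {1..n}" "order2 \<in> permutations_of_set {1..n}"
    and rp: "random_priority A R order1 A (\<lambda>_. undefined) = (x, t)"
    and sw: "swap_phase (\<lambda>l. canonical_intensity A (R l)) order2 x = (z, c, m)"
    and r_eq: "r = \<lparr> rp_allocation = x, final_allocation = z, searches = c,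
           running_time = length order1 + t + length order2 + c + m \<rparr>"
    by (rule set_pmf_extended_random_priority)
  have o1: "distinct order1" "set order1 = {1..n}" "length order1 = n"
    and o2: "distinct order2" "set order2 = {1..n}" "length order2 = n"
    using ord distinct_card[of order1] distinct_card[of order2]
    by (simp_all add: permutations_of_set_def)
  have pe: "pareto_efficient n A R x" and t: "t \<le> n * n"
    using pareto_efficient_random_priority[OF R o1(1,2) rp] by auto
  then have x: "bij_betw x {1..n} A" unfolding pareto_efficient_def allocation_def by blast
  have c: "c \<le> n choose 2" and m: "m \<le> n" using swap_phase_count[OF sw] o2(3) by auto
  have z: "bij_betw z {1..n} A" using swap_phase_bij_betw[OF sw _ x] o2(2) by simp
  \<comment> \<open>The item \<open>a\<close> witnesses that \<open>A\<close> is nonempty, from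
    which the canonical representation is known to exist.\<close>
  have "canonical_intensity A (R l) b a = - canonical_intensity A (R l) a b"
    if "l \<in> {1..n}" "a \<in> A" "b \<in> A" for l a b
    using R that canonical_intensity[of A "R l"] canonical_representation_skew
    unfolding strict_intensity_profile_def by (metis empty_iff)
  from swap_phase_dominates[OF sw o2(1,2) x this]
  have dom: "z = x \<or> intensity_dominates n (\<lambda>l. canonical_intensity A (R l)) z x" .
  \<comment> \<open>One quadratic term bounds the list entries read, the other crudely bounds the
    searches; the three linear terms are the two orders drawn and the repetitions.\<close>
  have "n choose 2 \<le> n * (n - 1)" unfolding choose_two by (rule div_le_dividend)
  also have "\<dots> \<le> n * n" by simp
  finally have "running_time r \<le> n + n * n + n + n * n + n"
    using t c m o1(3) o2(3) unfolding r_eq run.simps by linarith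
  then show "running_time r \<le> 2 * n ^ 2 + 3 * n" by (simp add: power2_eq_square)
  show "searches r \<le> n choose 2"
    and "pareto_efficient n A R (rp_allocation r)"
    and "allocation n A (final_allocation r)"
    and "final_allocation r = rp_allocation r \<or>
         intensity_dominates n (\<lambda>l. canonical_intensity A (R l)) (final_allocation r) (rp_allocation r)"
    using c pe z dom unfolding r_eq allocation_def by simp_all
qed

text \<open>\<open>T\<close> is chosen before the profile, so the quadratic bound is uniform over
  item sets, profiles and draws.\<close>

theorem proposition2:
  shows "(\<forall>n (A :: 'a set) R. strict_intensity_profile n A R \<longrightarrow>
            (\<forall>r\<in>set_pmf (extended_random_priority n A R).
               searches r \<le> n choose 2 \<and>
               pareto_efficient n A R (rp_allocation r) \<and>
               allocation n A (final_allocation r) \<and>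
               (final_allocation r = rp_allocation r \<or>
                intensity_dominates n (\<lambda>l. canonical_intensity A (R l))
                  (final_allocation r) (rp_allocation r)))) \<and>
         (\<exists>T :: nat \<Rightarrow> nat. (\<lambda>n. real (T n)) \<in> O(\<lambda>n. real n ^ 2) \<and>
            (\<forall>n (A :: 'a set) R. strict_intensity_profile n A R \<longrightarrow>
               (\<forall>r\<in>set_pmf (extended_random_priority n A R). running_time r \<le> T n)))"
proof (intro conjI)
  have "(\<lambda>n. real (2 * n ^ 2 + 3 * n)) \<in> O(\<lambda>n. real n ^ 2)"
  \<comment> \<open>The constant is \<open>2 + 3\<close>, since \<open>n \<le> n ^ 2\<close> for
    natural numbers.\<close>
  proof (rule landau_o.bigI[of 5])
    have "real (2 * n ^ 2 + 3 * n) \<le> 5 * real n ^ 2" for n :: nat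
      using of_nat_mono[of n "n ^ 2", where ?'a = real] by (simp add: power2_eq_square)
    then show "\<forall>\<^sub>F n in at_top. norm (real (2 * n ^ 2 + 3 * n)) \<le> 5 * norm (real n ^ 2)"
      by (intro always_eventually allI) (simp del: of_nat_add of_nat_mult)
  qed simp
  then show "\<exists>T :: nat \<Rightarrow> nat. (\<lambda>n. real (T n)) \<in> O(\<lambda>n. real n ^ 2) \<and>
      (\<forall>n (A :: 'a set) R. strict_intensity_profile n A R \<longrightarrow>
         (\<forall>r\<in>set_pmf (extended_random_priority n A R). running_time r \<le> T n))"
    using extended_random_priority_run(5) by (intro exI[of _ "\<lambda>n. 2 * n ^ 2 + 3 * n"]) blast
qed (use extended_random_priority_run(1-4) in blast)

end
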